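(* Let $f\in\mathbb{R}[x_1,\dots,x_n]$ ($n\ge1$) be a square-free polynomial in the variables $x=(x_1,\dots,x_n)=(\underline{x},x_n)$, where $\underline{x}=(x_1,\dots,x_{n-1})$. Then $$f(x)=(1-x_n)f(\underline{x},0)+x_nf(\underline{x},1).$$
   Context: A polynomial is square-free (multilinear) if it is a real linear combination of monomials $\prod_{i\in I}x_i$ with $I\subseteq\{1,\dots,n\}$. *)

theory Defs
  imports Complex_Main "HOL-Library.Poly_Mapping"
begin

text \<open>
  Formal real polynomials in the variables \<open>x\<^sub>i\<close>, \<open>i :: nat\<close>: finitely supported functions from
  exponent vectors to coefficients. The product on \<^type>\<open>poly_mapping\<close> is convolution, so this
  type is the polynomial ring; the ring in \<open>x\<^sub>1, \<dots>, x\<^sub>n\<close> is the subring of those polynomials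
  in which no other variable occurs.
\<close>

type_synonym real_mpoly = "(nat \<Rightarrow>\<^sub>0 nat) \<Rightarrow>\<^sub>0 real"

definition X :: "nat \<Rightarrow> real_mpoly" where
  "X i = Poly_Mapping.single (Poly_Mapping.single i 1) 1"

definition Const :: "real \<Rightarrow> real_mpoly" where
  "Const c = Poly_Mapping.single 0 c"

text \<open>
  Membership in the ring in \<open>x\<^sub>1, \<dots>, x\<^sub>n\<close> is part of the following predicate, since the index sets
  range over subsets of \<open>{1..n}\<close>. Distinct sets give distinct monomials.
\<close>

definition square_free_poly :: "nat \<Rightarrow> real_mpoly \<Rightarrow> bool" where
  "square_free_poly n f \<longleftrightarrow>
     (\<exists>c :: nat set \<Rightarrow> real. f = (\<Sum>I\<in>Pow {1..n}. Const (c I) * (\<Prod>i\<in>I. X i)))"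

text \<open>
  Simultaneous substitution of \<open>\<sigma> i\<close> for each variable \<open>x\<^sub>i\<close>. Thus \<open>mpoly_subst (X(n := 0)) f\<close> is
  \<open>f\<close> with \<open>x\<^sub>n\<close> set to \<open>0\<close> and the other variables kept.
\<close>

definition mpoly_subst :: "(nat \<Rightarrow> real_mpoly) \<Rightarrow> real_mpoly \<Rightarrow> real_mpoly" where
  "mpoly_subst \<sigma> f =
     (\<Sum>m\<in>Poly_Mapping.keys f. Const (Poly_Mapping.lookup f m) *
        (\<Prod>i\<in>Poly_Mapping.keys m. \<sigma> i ^ Poly_Mapping.lookup m i))"

end

theory Submission
  imports Defs
begin

text \<open>
  Both sides are linear in \<open>f\<close>, so it suffices to check the square-free monomials. If \<open>x\<^sub>n\<close> does not
  occur, both substitutions fix the monomial; if it does, the first kills the monomial and the second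
  removes the factor \<open>x\<^sub>n\<close>.
\<close>

lemma Const_zero [simp]: "Const 0 = 0"
  by (simp add: Const_def)

lemma Const_add: "Const (a + b) = Const a + Const b"
  by (simp add: Const_def single_add)

text \<open>Exponent vectors outside \<open>keys f\<close> have coefficient 0 and contribute
  nothing. A common index set is what additivity needs: by cancellation \<open>keys (f + g)\<close>
  can be smaller than the union of the two supports.\<close>

lemma mpoly_subst_superset:
  assumes "finite A" "Poly_Mapping.keys f \<subseteq> A"
  shows "mpoly_subst \<sigma> f = (\<Sum>m\<in>A. Const (Poly_Mapping.lookup f m) *
           (\<Prod>i\<in>Poly_Mapping.keys m. \<sigma> i ^ Poly_Mapping.lookup m i))"
  unfolding mpoly_subst_def
  using assms by (intro sum.mono_neutral_left) (auto simp: in_keys_iff)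

lemma mpoly_subst_zero: "mpoly_subst \<sigma> 0 = 0"
  by (simp add: mpoly_subst_def)

lemma mpoly_subst_add: "mpoly_subst \<sigma> (f + g) = mpoly_subst \<sigma> f + mpoly_subst \<sigma> g"
proof -
  let ?A = "Poly_Mapping.keys f \<union> Poly_Mapping.keys g"
  have "Poly_Mapping.keys (f + g) \<subseteq> ?A"
    by (rule Poly_Mapping.keys_add)
  then show ?thesis
    by (simp add: mpoly_subst_superset[of ?A] lookup_add Const_add distrib_right sum.distrib)
qed

lemma mpoly_subst_sum: "mpoly_subst \<sigma> (sum g A) = (\<Sum>a\<in>A. mpoly_subst \<sigma> (g a))"
  by (induction A rule: infinite_finite_induct) (simp_all add: mpoly_subst_zero mpoly_subst_add)

lemma mpoly_subst_single:
  "mpoly_subst \<sigma> (Poly_Mapping.single m c) =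
     Const c * (\<Prod>i\<in>Poly_Mapping.keys m. \<sigma> i ^ Poly_Mapping.lookup m i)"
  \<comment> \<open>Summing over \<open>{m}\<close> also covers \<open>c = 0\<close>, where the
    support is empty.\<close>
  by (simp add: mpoly_subst_superset[of "{m}"])

text \<open>Multiplication adds exponent vectors. The sum of unit vectors obtained here is the
  indicator function of \<open>I\<close>, and the form \<open>single\<close> makes
  \<open>mpoly_subst_single\<close> applicable.\<close>

lemma prod_X:
  assumes "finite I"
  shows "(\<Prod>i\<in>I. X i) = Poly_Mapping.single (\<Sum>i\<in>I. Poly_Mapping.single i 1) 1"
  using assms by induction (simp_all add: X_def mult_single)

lemma lookup_sum_single_one:
  assumes "finite I"
  shows "Poly_Mapping.lookup (\<Sum>i\<in>I. Poly_Mapping.single i (1::nat)) j = (if j \<in> I then 1 else 0)"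
  using assms by (simp add: lookup_sum lookup_single when_def)

lemma keys_sum_single_one:
  assumes "finite I"
  shows "Poly_Mapping.keys (\<Sum>i\<in>I. Poly_Mapping.single i (1::nat)) = I"
  using lookup_sum_single_one[OF assms] by (auto simp: in_keys_iff split: if_splits)

text \<open>The exponent vector has support \<open>I\<close> and only exponents 1 there, so each
  \<open>\<sigma> i\<close> with \<open>i\<close> in \<open>I\<close> enters exactly once.\<close>

lemma mpoly_subst_square_free_monomial:
  assumes "finite I"
  shows "mpoly_subst \<sigma> (Const c * (\<Prod>i\<in>I. X i)) = Const c * (\<Prod>i\<in>I. \<sigma> i)"
proof -
  have "Const c * (\<Prod>i\<in>I. X i) = Poly_Mapping.single (\<Sum>i\<in>I. Poly_Mapping.single i 1) c"
    using assms by (simp add: prod_X Const_def mult_single)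
  then show ?thesis
    \<comment> \<open>The exponent must stay \<open>1\<close>, not \<open>Suc 0\<close>, to match
      the lemmas on the indicator vector.\<close>
    using assms by (simp add: mpoly_subst_single keys_sum_single_one lookup_sum_single_one
        del: One_nat_def)
qed

lemma square_free_monomial_decomposition:
  fixes g :: real_mpoly
  assumes "finite I" and g: "g = Const c * (\<Prod>i\<in>I. X i)"
  shows "g = (1 - X n) * mpoly_subst (X(n := 0)) g + X n * mpoly_subst (X(n := 1)) g"
proof -
  have subst: "mpoly_subst \<sigma> g = Const c * prod \<sigma> I" for \<sigma>
    unfolding g by (rule mpoly_subst_square_free_monomial[OF \<open>finite I\<close>])
  show ?thesis
  proof (cases "n \<in> I")
    case True
    \<comment> \<open>A general \<open>p\<close> serves both substitutions: \<open>p = 0\<close>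
      gives 0, \<open>p = 1\<close> leaves the monomial without \<open>X n\<close>.\<close>
    have upd: "prod (X(n := p)) I = p * prod X (I - {n})" for p
      using prod.remove[OF \<open>finite I\<close> True, of "X(n := p)"] by simp
    have "g = Const c * (X n * prod X (I - {n}))"
      using prod.remove[OF \<open>finite I\<close> True, of X] by (simp add: g)
    then show ?thesis
      unfolding subst upd by (simp add: mult.left_commute)
  next
    case False
    then have upd: "prod (X(n := p)) I = prod X I" for p
      by (intro prod.cong) auto
    \<comment> \<open>Both substitutions return \<open>g\<close>, and the weights
      \<open>1 - X n\<close> and \<open>X n\<close> add up to 1.\<close>
    show ?thesis
      unfolding subst upd by (simp add: g algebra_simps)
  qed
qed

theorem lemma5:
  fixes n :: nat and f :: real_mpoly
  assumes "n \<ge> 1"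
    and "square_free_poly n f"
  shows "f = (1 - X n) * mpoly_subst (X(n := 0)) f + X n * mpoly_subst (X(n := 1)) f"
proof -
  from assms(2) obtain c where "f = (\<Sum>I\<in>Pow {1..n}. Const (c I) * (\<Prod>i\<in>I. X i))"
    unfolding square_free_poly_def by blast
  moreover define g where "g I = Const (c I) * (\<Prod>i\<in>I. X i)" for I
  ultimately have f: "f = (\<Sum>I\<in>Pow {1..n}. g I)"
    by simp
  have "g I = (1 - X n) * mpoly_subst (X(n := 0)) (g I) + X n * mpoly_subst (X(n := 1)) (g I)"
    if "I \<in> Pow {1..n}" for I
    using that finite_subset[of I "{1..n}"]
    by (intro square_free_monomial_decomposition[of I _ "c I"]) (auto simp: g_def)
  then have "(\<Sum>I\<in>Pow {1..n}. g I) =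
      (\<Sum>I\<in>Pow {1..n}. (1 - X n) * mpoly_subst (X(n := 0)) (g I)
                   + X n * mpoly_subst (X(n := 1)) (g I))"
    by (rule sum.cong[OF refl])
  then show ?thesis
    unfolding f mpoly_subst_sum sum_distrib_left sum.distrib .
qed

end
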